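(* Let $w\ge 0$ be an integer. Let $q$ be a complex number with $|q|<1$ and let $t\neq 0$ be a complex number such that the power series $G_w(t,q)$ converges absolutely. Let $\lambda$ be a root of $\lambda^2-\lambda(1-q)/t+1=0$ and put $\bar\lambda=1/\lambda$. Then, whenever all denominators occurring below (including those in the definitions of $\phi(\lambda,\cdot)$ and $\phi(\bar\lambda,\cdot)$) are nonzero, $$G_w(t,q)=\cfrac{1}{1-\dfrac{\lambda^2(1-q)\left[\bar{\lambda}^w\phi(\lambda,q^{3})\phi(\bar{\lambda},q^{w+3})-\lambda^w\phi(\bar{\lambda},q^{3})\phi(\lambda,q^{w+3})\right]}{(1+\lambda^2)\left[\bar{\lambda}^w\phi(\lambda,q^{2})\phi(\bar{\lambda},q^{w+3})-\lambda^{w+2}\phi(\bar{\lambda},q^{2})\phi(\lambda,q^{w+3})\right]}}\,.$$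
   Context: A Dyck path of length $2N$ is a lattice path from $(0,0)$ to $(2N,0)$ with $N$ steps $(1,1)$ and $N$ steps $(1,-1)$ that never goes below $y=0$. Its steps are labelled: $a_j$ is a step $(1,1)$ starting at height $j\ge 0$, and $b_k$ is a step $(1,-1)$ starting at height $k\ge1$. Thus a Dyck path is encoded as a word $u_1u_2\cdots u_{2N}$ in these labels. Given a possibility function $pos:\{a_0,a_1,\ldots\}\cup\{b_1,b_2,\ldots\}\to\mathbb{N}_0$, a path diagram is a Dyck path $u_1\cdots u_{2N}$ together with a sequence of integers $s_1,\ldots,s_{2N}$ with $0\le s_i\le pos(u_i)$ for all $i$. Here the possibility function is $pos(a_j)=j$ for $j\ge0$, $pos(b_k)=k$ for $k\ge1$. Let $a^{(w)}_{N,m}$ be the number of such path diagrams whose Dyck path has length $2N$ and never exceeds height $w$ (a slit of width $w$), and with $s_1+\cdots+s_{2N}=m$ (the empty path counts once for $N=0$, $m=0$). Define $$G_w(t,q)=\sum_{N,m\ge0}a^{(w)}_{N,m}t^{2N}q^m.$$ Notation: $(a;q)_n=\prod_{k=0}^{n-1}(1-aq^k)$, $i=\sqrt{-1}$, and $$\phi(\lambda,x)=\sum_{k=0}^\infty\frac{(i\lambda;q)_k(-i\lambda;q)_k\,x^k}{(\lambda^2q;q)_k(q;q)_k}.$$ *)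

theory Defs
  imports "HOL-Analysis.Analysis"
begin

datatype step = Up | Down

fun step_dir :: "step \<Rightarrow> int" where
  "step_dir Up = 1"
| "step_dir Down = - 1"

text \<open>The ordinate of the path after its first \<open>i\<close> steps; the abscissa is \<open>i\<close>.\<close>

definition height :: "step list \<Rightarrow> nat \<Rightarrow> int" where
  "height p i = sum_list (map step_dir (take i p))"

definition dyck_path :: "nat \<Rightarrow> step list \<Rightarrow> bool" where
  "dyck_path N p \<longleftrightarrow>
     length p = 2 * N \<and> count_list p Up = N \<and> count_list p Down = N \<and>
     (\<forall>i\<le>2 * N. 0 \<le> height p i)"

text \<open>\<open>LabA j\<close> is the label \<open>a\<^sub>j\<close> (\<open>j \<ge> 0\<close>) and \<open>LabB k\<close> is the label \<open>b\<^sub>k\<close>. For Dyck paths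
  only \<open>LabB k\<close> with \<open>k \<ge> 1\<close> occurs, so the value of a possibility function at \<open>LabB 0\<close> is
  irrelevant. Positions are counted from 0.\<close>

datatype label = LabA nat | LabB nat

definition step_label :: "step list \<Rightarrow> nat \<Rightarrow> label" where
  "step_label p i =
     (case p ! i of Up \<Rightarrow> LabA (nat (height p i)) | Down \<Rightarrow> LabB (nat (height p i)))"

definition path_diagram :: "(label \<Rightarrow> nat) \<Rightarrow> nat \<Rightarrow> step list \<Rightarrow> nat list \<Rightarrow> bool" where
  "path_diagram pos N p s \<longleftrightarrow>
     dyck_path N p \<and> length s = 2 * N \<and> (\<forall>i<2 * N. s ! i \<le> pos (step_label p i))"

fun pos :: "label \<Rightarrow> nat" where
  "pos (LabA j) = j"
| "pos (LabB k) = k"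

definition slit_diagrams :: "nat \<Rightarrow> nat \<Rightarrow> nat \<Rightarrow> (step list \<times> nat list) set" where
  "slit_diagrams w N m =
     {(p, s). path_diagram pos N p s \<and> (\<forall>i\<le>2 * N. height p i \<le> int w) \<and> sum_list s = m}"

lemma finite_slit_diagrams: "finite (slit_diagrams w N m)"
proof (rule finite_subset)
  show "slit_diagrams w N m \<subseteq>
      {p. set p \<subseteq> {Up, Down} \<and> length p = 2 * N} \<times> {s. set s \<subseteq> {..m} \<and> length s = 2 * N}"
  proof (rule subrelI)
    fix p s assume ps: "(p, s) \<in> slit_diagrams w N m"
    have "set p \<subseteq> {Up, Down}" using step.exhaust by blast
    moreover have "set s \<subseteq> {..m}"
      using ps member_le_sum_list[of _ s] by (auto simp: slit_diagrams_def)
    ultimately show "(p, s) \<in> {p. set p \<subseteq> {Up, Down} \<and> length p = 2 * N} \<times>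
        {s. set s \<subseteq> {..m} \<and> length s = 2 * N}"
      using ps by (simp add: slit_diagrams_def path_diagram_def dyck_path_def)
  qed
  show "finite ({p. set p \<subseteq> {Up, Down} \<and> length p = 2 * N} \<times>
      {s. set s \<subseteq> {..m} \<and> length s = 2 * N})"
    by (intro finite_cartesian_product finite_lists_length_eq) auto
qed

definition slit_coeff :: "nat \<Rightarrow> nat \<Rightarrow> nat \<Rightarrow> nat" where
  "slit_coeff w N m = card (slit_diagrams w N m)"

definition G_term :: "nat \<Rightarrow> complex \<Rightarrow> complex \<Rightarrow> nat \<times> nat \<Rightarrow> complex" where
  "G_term w t q = (\<lambda>(N, m). of_nat (slit_coeff w N m) * t ^ (2 * N) * q ^ m)"

definition G :: "nat \<Rightarrow> complex \<Rightarrow> complex \<Rightarrow> complex" where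
  "G w t q = (\<Sum>\<^sub>\<infinity>Nm\<in>UNIV. G_term w t q Nm)"

definition qpoch :: "complex \<Rightarrow> complex \<Rightarrow> nat \<Rightarrow> complex" where
  "qpoch a q n = (\<Prod>k<n. 1 - a * q ^ k)"

definition phi :: "complex \<Rightarrow> complex \<Rightarrow> complex \<Rightarrow> complex" where
  "phi q l x =
     (\<Sum>k. qpoch (\<i> * l) q k * qpoch (- \<i> * l) q k * x ^ k / (qpoch (l\<^sup>2 * q) q k * qpoch q q k))"

end

theory Submission
  imports Defs
begin

text \<open>Let \<open>y\<^sub>k\<close> be the generating function of the weighted paths in the slit from height \<open>k\<close> to
  height 0, so that \<open>G = y\<^sub>0\<close>. Summing the weights over the labels \<open>s\<^sub>i\<close>, a step starting at
  height \<open>k\<close> has weight \<open>t [k+1]\<^sub>q\<close>, whether it goes up or down. Removing the first step gives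
  \<open>y\<^sub>0 = 1 + t y\<^sub>1\<close> and \<open>y\<^sub>k = t [k+1]\<^sub>q (y\<^sub>k\<^sub>+\<^sub>1 + y\<^sub>k\<^sub>-\<^sub>1)\<close> for \<open>k \<ge> 1\<close>, with \<open>y\<^sub>w\<^sub>+\<^sub>1 = 0\<close>. Since
  \<open>(1 - q)/t = \<lambda> + 1/\<lambda>\<close>, the \<open>q\<close>-difference equation of \<open>\<phi>\<close> shows that \<open>\<lambda>\<^sup>k \<phi>(\<lambda>, q\<^sup>k\<^sup>+\<^sup>2)\<close>, and
  likewise the same expression in \<open>1/\<lambda>\<close>, solves this recurrence. The combination \<open>Y\<close> of the two
  that vanishes at \<open>w + 1\<close> is proportional to \<open>y\<close>, because the Casoratian of \<open>y\<close> and \<open>Y\<close> is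
  constant, and therefore \<open>y\<^sub>0 = 1 / (1 - t Y\<^sub>1 / Y\<^sub>0)\<close>.\<close>

subsection \<open>Weighted paths starting at an arbitrary height\<close>

text \<open>Path and labels are consumed together, so that removing the first step is mere
  computation. Both kinds of step allow labels up to their starting height, as \<open>pos\<close>
  treats \<open>LabA\<close> and \<open>LabB\<close> alike.\<close>

fun slit_valid :: "nat \<Rightarrow> nat \<Rightarrow> step list \<Rightarrow> nat list \<Rightarrow> bool" where
  "slit_valid w k [] [] \<longleftrightarrow> k = 0"
| "slit_valid w k (Up # p) (x # s) \<longleftrightarrow> x \<le> k \<and> k < w \<and> slit_valid w (Suc k) p s"
| "slit_valid w k (Down # p) (x # s) \<longleftrightarrow> x \<le> k \<and> 0 < k \<and> slit_valid w (k - 1) p s"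
| "slit_valid w k _ _ \<longleftrightarrow> False"

lemma height_0 [simp]: "height p 0 = 0"
  by (simp add: height_def)

lemma height_Cons_Suc [simp]: "height (u # p) (Suc i) = step_dir u + height p i"
  by (simp add: height_def)

lemma all_le_Suc_conv: "(\<forall>i\<le>Suc n. P i) \<longleftrightarrow> P 0 \<and> (\<forall>i\<le>n. P (Suc i))"
  by (metis Suc_le_mono le0 not0_implies_Suc)

text \<open>The recursive predicate tests the ceiling only at up steps, the height condition at
  every index including 0; \<open>k \<le> w\<close> closes this gap.\<close>

lemma slit_valid_iff:
  assumes "k \<le> w"
  shows "slit_valid w k p s \<longleftrightarrow>
     length s = length p \<and> (\<forall>i\<le>length p. 0 \<le> int k + height p i \<and> int k + height p i \<le> int w) \<and>
     int k + height p (length p) = 0 \<and> (\<forall>i<length p. int (s ! i) \<le> int k + height p i)"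
  using assms
proof (induction p arbitrary: k s)
  case Nil
  then show ?case by (cases s) auto
next
  case (Cons u p)
  show ?case
  proof (cases s)
    case Nil
    then show ?thesis by (cases u) auto
  next
    case s: (Cons x s')
    show ?thesis
    proof (cases u)
      case Up
      show ?thesis
      proof (cases "k < w")
        case True
        then show ?thesis
          using Cons.IH[of "Suc k" s'] Cons.prems s Up
          by (simp add: all_le_Suc_conv All_less_Suc2 algebra_simps) blast
      next
        case False
        have "\<not> int k + height (Up # p) (Suc 0) \<le> int w" using False by simp
        then show ?thesis using False s Up by fastforce
      qed
    next
      case Down
      show ?thesis
      proof (cases "0 < k")
        case True
        then show ?thesis
          using Cons.IH[of "k - 1" s'] Cons.prems s Down
          by (simp add: all_le_Suc_conv All_less_Suc2 algebra_simps of_nat_diff) blast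
      next
        case False
        have "\<not> 0 \<le> int k + height (Down # p) (Suc 0)" using False by simp
        then show ?thesis using False s Down by fastforce
      qed
    qed
  qed
qed

lemma height_length: "height p (length p) = int (count_list p Up) - int (count_list p Down)"
proof (induction p)
  case (Cons u p)
  then show ?case by (cases u) auto
qed simp

lemma count_Up_Down: "count_list p Up + count_list p Down = length p"
proof (induction p)
  case (Cons u p)
  then show ?case by (cases u) auto
qed simp

lemma pos_step_label: "pos (step_label p i) = nat (height p i)"
  by (simp add: step_label_def split: step.splits)

definition slit_set :: "nat \<Rightarrow> nat \<Rightarrow> nat \<Rightarrow> (step list \<times> nat list) set" where
  "slit_set w n k = {(p, s). length p = n \<and> slit_valid w k p s}"

lemma slit_diagrams_eq:
  "slit_diagrams w N m = {d \<in> slit_set w (2 * N) 0. sum_list (snd d) = m}"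
proof -
  have "path_diagram pos N p s \<and> (\<forall>i\<le>2 * N. height p i \<le> int w) \<longleftrightarrow>
      length p = 2 * N \<and> slit_valid w 0 p s" for p s
  proof -
    \<comment> \<open>The numbers of up and down steps have sum \<open>2 * N\<close> and difference
      the final height, so both are \<open>N\<close> exactly when the path ends at 0.\<close>
    have "dyck_path N p \<longleftrightarrow> length p = 2 * N \<and> height p (length p) = 0 \<and>
        (\<forall>i\<le>2 * N. 0 \<le> height p i)"
      using height_length[of p] count_Up_Down[of p] by (auto simp: dyck_path_def)
    then show ?thesis
      unfolding path_diagram_def slit_valid_iff[of 0 w, simplified] pos_step_label
      by (auto simp: le_nat_iff)
  qed
  then show ?thesis by (auto simp: slit_diagrams_def slit_set_def)
qed

section \<open>Label sums as q-weights of paths\<close>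

definition qbracket :: "'a::comm_semiring_1 \<Rightarrow> nat \<Rightarrow> 'a" where
  "qbracket q k = (\<Sum>x\<le>k. q ^ x)"

text \<open>The semiring is left general because the same polynomial is needed at the complex
  \<open>q\<close> and at the real \<open>norm q\<close>.\<close>

fun path_weight :: "nat \<Rightarrow> 'a::comm_semiring_1 \<Rightarrow> nat \<Rightarrow> nat \<Rightarrow> 'a" where
  "path_weight w q 0 k = (if k = 0 then 1 else 0)"
| "path_weight w q (Suc n) k = qbracket q k *
     ((if k < w then path_weight w q n (Suc k) else 0) +
      (if 0 < k then path_weight w q n (k - 1) else 0))"

lemma slit_set_0: "slit_set w 0 k = (if k = 0 then {([], [])} else {})"
proof -
  have "slit_valid w k [] s \<longleftrightarrow> k = 0 \<and> s = []" for s by (cases s) auto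
  then show ?thesis by (auto simp: slit_set_def)
qed

lemma slit_set_Suc:
  "slit_set w (Suc n) k =
     (\<lambda>(x, p, s). (Up # p, x # s)) ` ({..k} \<times> (if k < w then slit_set w n (Suc k) else {})) \<union>
     (\<lambda>(x, p, s). (Down # p, x # s)) ` ({..k} \<times> (if 0 < k then slit_set w n (k - 1) else {}))"
    (is "_ = ?U \<union> ?D")
proof (intro set_eqI)
  fix d :: "step list \<times> nat list"
  obtain p s where d: "d = (p, s)" by (cases d)
  show "d \<in> slit_set w (Suc n) k \<longleftrightarrow> d \<in> ?U \<union> ?D"
    unfolding d slit_set_def
    by (cases "(w, k, p, s)" rule: slit_valid.cases) (auto simp: image_iff)
qed

text \<open>The label of the first step is independent of the rest of the diagram, so its geometric
  sum \<open>qbracket q k\<close> factors out. Finiteness is carried along because splitting the sum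
  over the union needs it.\<close>

lemma slit_set_weight:
  fixes q :: "'a::comm_semiring_1"
  shows "finite (slit_set w n k) \<and>
    (\<Sum>d\<in>slit_set w n k. q ^ sum_list (snd d)) = path_weight w q n k"
proof (induction n arbitrary: k)
  case 0
  show ?case by (simp add: slit_set_0)
next
  case (Suc n)
  have fin: "finite (slit_set w n j)" for j using Suc by blast
  have weight: "(\<Sum>d\<in>slit_set w n j. q ^ sum_list (snd d)) = path_weight w q n j" for j
    using Suc by blast
  have step: "(\<Sum>d\<in>(\<lambda>(x, p, s). (u # p, x # s)) ` ({..k} \<times> B). q ^ sum_list (snd d)) =
      qbracket q k * (\<Sum>d\<in>B. q ^ sum_list (snd d))" for u :: step and B
  proof -
    have "inj_on (\<lambda>(x, p, s). (u # p, x # s)) ({..k} \<times> B)" by (auto simp: inj_on_def)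
    then have "(\<Sum>d\<in>(\<lambda>(x, p, s). (u # p, x # s)) ` ({..k} \<times> B). q ^ sum_list (snd d)) =
        (\<Sum>(x, d)\<in>{..k} \<times> B. q ^ x * q ^ sum_list (snd d))"
      by (subst sum.reindex) (auto simp: power_add intro!: sum.cong)
    also have "\<dots> = qbracket q k * (\<Sum>d\<in>B. q ^ sum_list (snd d))"
      by (simp add: sum.cartesian_product[symmetric] qbracket_def sum_product)
    finally show ?thesis .
  qed
  show ?case
    unfolding slit_set_Suc
    by (subst sum.union_disjoint) (auto simp: fin step weight algebra_simps)
qed

text \<open>The finite set of diagrams is grouped by label sum; only finitely many \<open>m\<close>
  occur, so the series over \<open>m\<close> is a finite sum.\<close>

lemma slit_coeff_has_sum:
  fixes q :: "'a::real_normed_field"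
  shows "((\<lambda>m. of_nat (slit_coeff w N m) * q ^ m) has_sum path_weight w q (2 * N) 0) UNIV"
proof -
  define S where "S = slit_set w (2 * N) 0"
  define I where "I = (\<lambda>d. sum_list (snd d)) ` S"
  have fin: "finite S" unfolding S_def using slit_set_weight by blast
  have coeff: "of_nat (slit_coeff w N m) * q ^ m =
      (\<Sum>d\<in>{d \<in> S. sum_list (snd d) = m}. q ^ sum_list (snd d))" for m
    by (simp add: slit_coeff_def slit_diagrams_eq S_def)
  have "(\<Sum>m\<in>I. of_nat (slit_coeff w N m) * q ^ m) = (\<Sum>d\<in>S. q ^ sum_list (snd d))"
    unfolding coeff by (rule sum.group) (auto simp: fin I_def)
  then have "((\<lambda>m. of_nat (slit_coeff w N m) * q ^ m) has_sum path_weight w q (2 * N) 0) I"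
    using slit_set_weight[where q = q and w = w and n = "2 * N" and k = 0] fin
    by (auto intro!: has_sum_finiteI simp: I_def S_def)
  moreover have "of_nat (slit_coeff w N m) * q ^ m = 0" if "m \<notin> I" for m
  proof -
    have "{d \<in> S. sum_list (snd d) = m} = {}" using that by (force simp: I_def)
    then show ?thesis unfolding coeff by (simp only: sum.empty)
  qed
  ultimately show ?thesis
    by (subst has_sum_cong_neutral[where T = I and g = "\<lambda>m. of_nat (slit_coeff w N m) * q ^ m"]) auto
qed

section \<open>Parity and norm bounds for path weights\<close>

lemma path_weight_odd: "odd (n + k) \<Longrightarrow> path_weight w q n k = 0"
proof (induction n arbitrary: k)
  case 0
  then show ?case by (auto simp: odd_pos)
next
  case (Suc n)
  then show ?case by auto
qed

lemma qbracket_ge_1: "0 \<le> (q::real) \<Longrightarrow> 1 \<le> qbracket q k"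
  unfolding qbracket_def
  using member_le_sum[of 0 "{..k}" "\<lambda>x. q ^ x"] by simp

lemma path_weight_nonneg: "0 \<le> (q::real) \<Longrightarrow> 0 \<le> path_weight w q n k"
  using qbracket_ge_1[of q] order_trans[OF zero_le_one]
  by (induction n arbitrary: k) (auto intro!: mult_nonneg_nonneg)

text \<open>\<open>path_weight\<close> is a polynomial in \<open>q\<close> with nonnegative
  coefficients. The real majorant carries all convergence arguments below for paths.\<close>

lemma norm_path_weight_le:
  fixes q :: "'a::real_normed_field"
  shows "norm (path_weight w q n k) \<le> path_weight w (norm q) n k"
proof (induction n arbitrary: k)
  case (Suc n)
  have "norm (qbracket q k) \<le> qbracket (norm q) k"
    unfolding qbracket_def by (rule sum_norm_le) (simp add: norm_power)
  moreover have "norm ((if k < w then path_weight w q n (Suc k) else 0) +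
      (if 0 < k then path_weight w q n (k - 1) else 0)) \<le>
      (if k < w then path_weight w (norm q) n (Suc k) else 0) +
      (if 0 < k then path_weight w (norm q) n (k - 1) else 0)"
    by (rule norm_triangle_le, rule add_mono) (auto simp: Suc simp del: One_nat_def)
  moreover have "0 \<le> qbracket (norm q) k"
    using qbracket_ge_1[of "norm q" k] by simp
  ultimately show ?case
    unfolding path_weight.simps norm_mult by (intro mult_mono) auto
qed simp

text \<open>Prefixing \<open>k\<close> up steps with label 0 embeds the paths from height \<open>k\<close> into those from
  height 0.\<close>

lemma path_weight_le_from_0:
  assumes "0 \<le> (q::real)" "k \<le> w"
  shows "path_weight w q n k \<le> path_weight w q (n + k) 0"
  using assms(2)
proof (induction k arbitrary: n)
  case (Suc k)
  have "path_weight w q n (Suc k) = 1 * path_weight w q n (Suc k)" by simp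
  also have "\<dots> \<le> qbracket q k * (path_weight w q n (Suc k) +
      (if 0 < k then path_weight w q n (k - 1) else 0))"
    using Suc.prems path_weight_nonneg[OF assms(1)] qbracket_ge_1[OF assms(1), of k]
    by (intro mult_mono) (auto intro: add_nonneg_nonneg)
  also have "\<dots> = path_weight w q (Suc n) k" using Suc.prems by simp
  also have "\<dots> \<le> path_weight w q (Suc n + k) 0" using Suc by (intro Suc.IH) auto
  finally show ?case by simp
qed simp

lemma qbracket_mult: "(1 - q) * qbracket q k = 1 - (q::complex) ^ Suc k"
  unfolding qbracket_def using one_diff_power_eq[of q "Suc k"] by (simp add: lessThan_Suc_atMost)

subsection \<open>The generating functions of paths by starting height\<close>

text \<open>The value 0 above \<open>w\<close> is the boundary condition that closes the recurrence
  at the ceiling.\<close>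

definition path_gf :: "nat \<Rightarrow> complex \<Rightarrow> complex \<Rightarrow> nat \<Rightarrow> complex" where
  "path_gf w t q k = (if k \<le> w then \<Sum>n. t ^ n * path_weight w q n k else 0)"

lemma infsum_nat_eq_suminf:
  fixes f :: "nat \<Rightarrow> 'a::banach"
  assumes "(\<lambda>n. norm (f n)) summable_on UNIV"
  shows "infsum f UNIV = suminf f"
  using assms has_sum_imp_sums[OF has_sum_infsum[OF abs_summable_summable]]
  by (metis sums_unique)

text \<open>Absolute summability over pairs permits summing over \<open>m\<close> first. Done for
  the norms, this gives the real majorant series at \<open>norm q\<close>; done for the terms, it
  gives the value of \<open>G\<close>.\<close>

lemma
  assumes abs: "(\<lambda>Nm. norm (G_term w t q Nm)) summable_on UNIV"
  shows summable_path_weight_0: "summable (\<lambda>n. norm t ^ n * path_weight w (norm q) n 0)"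
    and G_eq_path_gf: "G w t q = path_gf w t q 0"
proof -
  have row: "((\<lambda>m. G_term w t q (N, m)) has_sum t ^ (2 * N) * path_weight w q (2 * N) 0) UNIV" for N
    using has_sum_cmult_right[OF slit_coeff_has_sum[of w N q], of "t ^ (2 * N)"]
    by (simp add: G_term_def mult_ac)
  have row_norm: "((\<lambda>m. norm (G_term w t q (N, m))) has_sum
      norm t ^ (2 * N) * path_weight w (norm q) (2 * N) 0) UNIV" for N
    using has_sum_cmult_right[OF slit_coeff_has_sum[of w N "norm q"], of "norm t ^ (2 * N)"]
    by (simp add: G_term_def norm_mult norm_power mult_ac)
  have abs': "(\<lambda>Nm. norm (G_term w t q Nm)) summable_on UNIV \<times> UNIV" using abs by simp
  have even_odd: "range ((*) (2::nat)) = {n. even n}" by (auto elim: evenE)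
  have inj2: "inj ((*) (2::nat))" by (auto intro: injI)
  have "(\<lambda>N. norm t ^ (2 * N) * path_weight w (norm q) (2 * N) 0) summable_on UNIV"
    using summable_on_Sigma_banach[of "\<lambda>N m. norm (G_term w t q (N, m))" UNIV "\<lambda>_. UNIV"] abs'
      infsumI[OF row_norm] by (simp add: case_prod_unfold)
  then have "(\<lambda>n. norm t ^ n * path_weight w (norm q) n 0) summable_on range ((*) 2)"
    by (subst summable_on_reindex[OF inj2]) (simp add: o_def)
  \<comment> \<open>Odd lengths contribute 0, so the index may run over all \<open>n\<close> instead
    of the even ones.\<close>
  then have *: "(\<lambda>n. norm t ^ n * path_weight w (norm q) n 0) summable_on UNIV"
    by (rule summable_on_cong_neutral[THEN iffD1, rotated -1])
       (auto simp: even_odd path_weight_odd)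
  then show "summable (\<lambda>n. norm t ^ n * path_weight w (norm q) n 0)"
    by (rule summable_on_imp_summable)
  have abs0: "(\<lambda>n. norm (t ^ n * path_weight w q n 0)) summable_on UNIV"
    by (rule summable_on_comparison_test[OF *])
       (auto simp: norm_mult norm_power intro!: mult_left_mono norm_path_weight_le)
  have "G w t q = infsum (G_term w t q) (UNIV \<times> UNIV)" by (simp add: G_def)
  also have "\<dots> = (\<Sum>\<^sub>\<infinity>N. \<Sum>\<^sub>\<infinity>m. G_term w t q (N, m))"
    by (rule infsum_Sigma_banach[symmetric, OF abs_summable_summable[OF abs']])
  also have "\<dots> = (\<Sum>\<^sub>\<infinity>N. t ^ (2 * N) * path_weight w q (2 * N) 0)"
    using infsumI[OF row] by simp
  also have "\<dots> = (\<Sum>\<^sub>\<infinity>n\<in>range ((*) 2). t ^ n * path_weight w q n 0)"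
    by (subst infsum_reindex[OF inj2]) (simp add: o_def)
  also have "\<dots> = (\<Sum>\<^sub>\<infinity>n. t ^ n * path_weight w q n 0)"
    by (rule infsum_cong_neutral) (auto simp: even_odd path_weight_odd)
  also have "\<dots> = path_gf w t q 0"
    using infsum_nat_eq_suminf[OF abs0] by (simp add: path_gf_def)
  finally show "G w t q = path_gf w t q 0" .
qed

text \<open>The hypothesis concerns paths from height 0 only. Embedding the others there costs
  \<open>k\<close> extra steps, hence a factor \<open>norm t ^ k\<close>, which is divided
  out.\<close>

lemma summable_path_weight:
  assumes "(\<lambda>Nm. norm (G_term w t q Nm)) summable_on UNIV" "t \<noteq> 0" "k \<le> w"
  shows "summable (\<lambda>n. t ^ n * path_weight w q n k)"
proof (rule summable_comparison_test')
  have "summable (\<lambda>n. norm t ^ (n + k) * path_weight w (norm q) (n + k) 0)"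
    using summable_path_weight_0[OF assms(1)]
    by (subst summable_iff_shift[where f = "\<lambda>n. norm t ^ n * path_weight w (norm q) n 0"])
  then show "summable (\<lambda>n. inverse (norm t ^ k) *
      (norm t ^ (n + k) * path_weight w (norm q) (n + k) 0))"
    by (rule summable_mult)
  fix n
  have "norm (t ^ n * path_weight w q n k) \<le> norm t ^ n * path_weight w (norm q) (n + k) 0"
    using order_trans[OF norm_path_weight_le path_weight_le_from_0[OF norm_ge_zero assms(3)]]
    by (auto simp: norm_mult norm_power intro!: mult_left_mono)
  also have "\<dots> = inverse (norm t ^ k) *
      (norm t ^ (n + k) * path_weight w (norm q) (n + k) 0)"
    using assms(2) by (simp add: power_add)
  finally show "norm (t ^ n * path_weight w q n k) \<le> \<dots>" .
qed

lemma path_gf_rec: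
  assumes "(\<lambda>Nm. norm (G_term w t q Nm)) summable_on UNIV" "t \<noteq> 0" "k \<le> w"
  shows "path_gf w t q k = (if k = 0 then 1 else 0) + t * qbracket q k *
    (path_gf w t q (Suc k) + (if 0 < k then path_gf w t q (k - 1) else 0))"
proof -
  define a where "a = (\<lambda>j n. t ^ n * path_weight w q n j)"
  have sm: "summable (a j)" if "j \<le> w" for j
    unfolding a_def using summable_path_weight[OF assms(1,2) that] .
  have up: "(\<lambda>n. if k < w then a (Suc k) n else 0) sums path_gf w t q (Suc k)"
    using summable_sums[OF sm[of "Suc k"]] by (auto simp: path_gf_def a_def Suc_le_eq)
  have down: "(\<lambda>n. if 0 < k then a (k - 1) n else 0) sums
      (if 0 < k then path_gf w t q (k - 1) else 0)"
    using summable_sums[OF sm[of "k - 1"]] assms(3) by (auto simp: path_gf_def a_def)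
  have "a k (Suc n) = t * qbracket q k *
      ((if k < w then a (Suc k) n else 0) + (if 0 < k then a (k - 1) n else 0))" for n
    by (simp add: a_def algebra_simps)
  then have "(\<lambda>n. a k (Suc n)) sums (t * qbracket q k *
      (path_gf w t q (Suc k) + (if 0 < k then path_gf w t q (k - 1) else 0)))"
    using sums_mult[OF sums_add[OF up down], of "t * qbracket q k"] by simp
  \<comment> \<open>The term at \<open>n = 0\<close> belongs to the empty path and is 1 only for
    height 0.\<close>
  from sums_unique[OF sums_Suc[OF this]] show ?thesis
    using assms(3) by (simp add: path_gf_def a_def add.commute)
qed

subsection \<open>The q-difference equation\<close>

definition phi_coeff :: "complex \<Rightarrow> complex \<Rightarrow> nat \<Rightarrow> complex" where
  "phi_coeff q l k =
     qpoch (\<i> * l) q k * qpoch (- \<i> * l) q k / (qpoch (l\<^sup>2 * q) q k * qpoch q q k)"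

lemma phi_eq: "phi q l x = (\<Sum>k. phi_coeff q l k * x ^ k)"
  by (simp add: phi_def phi_coeff_def)

text \<open>The two new numerator factors, with \<open>\<i> * l\<close> and
  \<open>- \<i> * l\<close>, multiply to a real-looking \<open>1 + l\<^sup>2 * q ^ (2 * k)\<close>.
  The new denominator factors divide the denominator at \<open>Suc k\<close>, so they do not
  vanish.\<close>

lemma phi_coeff_Suc:
  assumes "\<And>k. qpoch (l\<^sup>2 * q) q k * qpoch q q k \<noteq> 0"
  shows "(1 - l\<^sup>2 * q ^ Suc k) * (1 - q ^ Suc k) \<noteq> 0"
    and "phi_coeff q l (Suc k) =
      phi_coeff q l k * ((1 + l\<^sup>2 * q ^ (2 * k)) / ((1 - l\<^sup>2 * q ^ Suc k) * (1 - q ^ Suc k)))"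
proof -
  show "(1 - l\<^sup>2 * q ^ Suc k) * (1 - q ^ Suc k) \<noteq> 0"
    using assms[of "Suc k"] by (auto simp: qpoch_def mult.assoc)
  have "(1 - \<i> * l * q ^ k) * (1 + \<i> * l * q ^ k) = 1 - (\<i> * \<i>) * (l * l) * (q ^ k * q ^ k)"
    by (simp add: algebra_simps)
  then have "(1 - \<i> * l * q ^ k) * (1 + \<i> * l * q ^ k) = 1 + l\<^sup>2 * q ^ (2 * k)"
    by (simp add: power2_eq_square mult_2 power_add)
  moreover have "qpoch a q (Suc k) = qpoch a q k * (1 - a * q ^ k)" for a
    by (simp add: qpoch_def)
  moreover have "(A * a) * (B * b) / ((C * c) * (D * d)) = A * B / (C * D) * (a * b / (c * d))"
    for A B C D a b c d :: complex
    by (simp add: mult_ac)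
  ultimately show "phi_coeff q l (Suc k) =
      phi_coeff q l k * ((1 + l\<^sup>2 * q ^ (2 * k)) / ((1 - l\<^sup>2 * q ^ Suc k) * (1 - q ^ Suc k)))"
    unfolding phi_coeff_def by (simp add: mult.assoc)
qed

text \<open>Since the powers of \<open>q\<close> tend to 0, the ratio \<open>r\<close> of successive
  coefficients tends to 1, and the ratio test applies with any \<open>c\<close> strictly between
  \<open>norm x\<close> and 1.\<close>

lemma summable_phi:
  assumes "norm q < 1" "norm x < 1"
    and nz: "\<And>k. qpoch (l\<^sup>2 * q) q k * qpoch q q k \<noteq> 0"
  shows "summable (\<lambda>k. phi_coeff q l k * x ^ k)"
proof -
  define r where "r = (\<lambda>k. (1 + l\<^sup>2 * q ^ (2 * k)) / ((1 - l\<^sup>2 * q ^ Suc k) * (1 - q ^ Suc k)))"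
  obtain c where c: "norm x < c" "c < 1" using dense[OF assms(2)] by blast
  have q0: "(\<lambda>k. q ^ k) \<longlonglongrightarrow> 0" using assms(1) by (rule LIMSEQ_power_zero)
  have q1: "(\<lambda>k. q ^ Suc k) \<longlonglongrightarrow> 0" using q0 by (rule LIMSEQ_Suc)
  have q2: "(\<lambda>k. q ^ (2 * k)) \<longlonglongrightarrow> 0"
    using tendsto_mult[OF q0 q0] by (simp add: mult_2 power_add)
  have "r \<longlonglongrightarrow> (1 + l\<^sup>2 * 0) / ((1 - l\<^sup>2 * 0) * (1 - 0))"
    unfolding r_def by (intro tendsto_intros q1 q2) auto
  then have "(\<lambda>k. norm (r k * x)) \<longlonglongrightarrow> norm (1 * x)"
    by (intro tendsto_intros) simp
  then have "\<forall>\<^sub>F k in sequentially. norm (r k * x) < c"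
    using c by (intro order_tendstoD) auto
  then obtain K where K: "\<And>k. k \<ge> K \<Longrightarrow> norm (r k * x) < c"
    by (auto simp: eventually_sequentially)
  show ?thesis
  proof (rule summable_ratio_test[OF c(2)])
    fix k assume "K \<le> k"
    have "phi_coeff q l (Suc k) * x ^ Suc k = (r k * x) * (phi_coeff q l k * x ^ k)"
      by (subst phi_coeff_Suc(2)[OF nz]) (simp add: r_def)
    then show "norm (phi_coeff q l (Suc k) * x ^ Suc k) \<le> c * norm (phi_coeff q l k * x ^ k)"
      using K[OF \<open>K \<le> k\<close>]
      by (simp only: norm_mult[of "r k * x"]) (intro mult_right_mono, simp_all)
  qed
qed

text \<open>The bracket on the right is the series \<open>E\<close> with coefficients
  \<open>e n\<close>, so \<open>(1 - x) * E\<close> has coefficient \<open>e (Suc n) - e n\<close>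
  at \<open>x ^ Suc n\<close>. The ratio formula makes this difference collapse to the corresponding
  coefficient on the left.\<close>

lemma phi_q_difference:
  assumes "norm q < 1" "norm x < 1"
    and nz: "\<And>k. qpoch (l\<^sup>2 * q) q k * qpoch q q k \<noteq> 0"
  shows "(1 + l\<^sup>2) * phi q l (q * x) = (1 - x) * (l\<^sup>2 * phi q l (q\<^sup>2 * x) + phi q l x)"
proof -
  define d where "d = phi_coeff q l"
  define e where "e = (\<lambda>n. (1 + l\<^sup>2 * q ^ (2 * n)) * d n)"
  have le1: "norm (q ^ j * x) < 1" for j
    using assms(1,2) power_le_one[of "norm q" j] mult_le_one[of "norm q ^ j" "norm x"]
      mult_left_le_one_le[of "norm x" "norm q ^ j"]
    by (simp add: norm_mult norm_power)
  have S: "(\<lambda>n. d n * (q ^ j * x) ^ n) sums phi q l (q ^ j * x)" for j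
    using summable_sums[OF summable_phi[OF assms(1) le1 nz]] by (simp add: phi_eq d_def)
  have rec: "e (Suc n) - e n = (1 + l\<^sup>2) * q ^ Suc n * d (Suc n)" for n
  proof -
    define Q where "Q = q ^ Suc n"
    have "e n = d (Suc n) * ((1 - l\<^sup>2 * Q) * (1 - Q))"
      using phi_coeff_Suc(1)[OF nz, of n]
      by (simp add: d_def e_def Q_def phi_coeff_Suc(2)[OF nz])
    moreover have "e (Suc n) = (1 + l\<^sup>2 * (Q * Q)) * d (Suc n)"
      by (simp only: e_def Q_def mult_2 power_add)
    ultimately show ?thesis unfolding Q_def[symmetric] by (simp add: algebra_simps)
  qed
  define E where "E = l\<^sup>2 * phi q l (q\<^sup>2 * x) + phi q l x"
  have E: "(\<lambda>n. e n * x ^ n) sums E"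
    using sums_add[OF sums_mult[OF S[of 2], of "l\<^sup>2"] S[of 0]]
    by (simp add: E_def e_def algebra_simps power_mult_distrib flip: power_mult)
  have "(\<lambda>n. e (Suc n) * x ^ Suc n) sums (E - e 0)"
    using E by (subst sums_Suc_iff) simp
  then have "(\<lambda>n. e (Suc n) * x ^ Suc n - x * (e n * x ^ n)) sums (E - e 0 - x * E)"
    by (intro sums_diff sums_mult E)
  then have "(\<lambda>n. (e (Suc n) - e n) * x ^ Suc n) sums (E - e 0 - x * E)"
    by (simp add: algebra_simps)
  moreover have "(\<lambda>n. (1 + l\<^sup>2) * (d (Suc n) * (q * x) ^ Suc n)) sums
      ((1 + l\<^sup>2) * (phi q l (q * x) - d 0))"
    using S[of 1] by (intro sums_mult) (subst sums_Suc_iff, simp)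
  ultimately have "E - e 0 - x * E = (1 + l\<^sup>2) * (phi q l (q * x) - d 0)"
    by (intro sums_unique2) (simp_all add: rec power_mult_distrib mult_ac)
  moreover have "e 0 = (1 + l\<^sup>2) * d 0" by (simp add: e_def)
  ultimately have "(1 + l\<^sup>2) * phi q l (q * x) = (1 - x) * E" by (simp add: algebra_simps)
  then show ?thesis by (simp only: E_def)
qed

text \<open>This is the q-difference equation at \<open>x = q ^ (k + 2)\<close>, times
  \<open>l ^ k\<close>. The factor \<open>l + 1 / l\<close> is invariant under inverting
  \<open>l\<close>, so both roots give the same recurrence.\<close>

lemma phi_height_rec:
  assumes "norm q < 1" "l \<noteq> 0"
    and nz: "\<And>k. qpoch (l\<^sup>2 * q) q k * qpoch q q k \<noteq> 0"
  shows "(l + 1 / l) * (l ^ Suc k * phi q l (q ^ (k + 3))) = (1 - q ^ (k + 2)) *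
    (l ^ (k + 2) * phi q l (q ^ (k + 4)) + l ^ k * phi q l (q ^ (k + 2)))"
proof -
  have "norm (q ^ (k + 2)) < 1"
    using assms(1) power_Suc_less_one[of "norm q" "Suc k"]
    by (cases "q = 0") (simp_all add: norm_mult norm_power)
  from phi_q_difference[OF assms(1) this nz]
  have difference: "(1 + l\<^sup>2) * phi q l (q ^ (k + 3)) =
      (1 - q ^ (k + 2)) * (l\<^sup>2 * phi q l (q ^ (k + 4)) + phi q l (q ^ (k + 2)))"
    by (simp add: power_add power2_eq_square power3_eq_cube eval_nat_numeral mult_ac)
  have "(l + 1 / l) * (l ^ Suc k * phi q l (q ^ (k + 3))) =
      l ^ k * ((1 + l\<^sup>2) * phi q l (q ^ (k + 3)))"
    using assms(2) by (simp add: field_simps power2_eq_square)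
  also have "\<dots> = (1 - q ^ (k + 2)) *
      (l ^ (k + 2) * phi q l (q ^ (k + 4)) + l ^ k * phi q l (q ^ (k + 2)))"
    unfolding difference by (simp only: power_add) (simp only: distrib_left mult_ac)
  finally show ?thesis .
qed

section \<open>Boundary conditions and the closed form\<close>

lemma casoratian_zero:
  fixes y Y c :: "nat \<Rightarrow> 'a::field"
  assumes "\<And>k. k < w \<Longrightarrow> c k * y (Suc k) = y (k + 2) + y k"
    and "\<And>k. k < w \<Longrightarrow> c k * Y (Suc k) = Y (k + 2) + Y k"
    and "y (Suc w) = 0" "Y (Suc w) = 0"
  shows "y 0 * Y 1 = y 1 * Y 0"
proof -
  \<comment> \<open>The induction descends from \<open>w\<close>, where both sides vanish; the terms
    with \<open>c k\<close> cancel at each step.\<close>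
  have "y k * Y (Suc k) = y (Suc k) * Y k" if "k \<le> w" for k
    using that
  proof (induction k rule: inc_induct)
    case base
    then show ?case using assms(3,4) by simp
  next
    case (step k)
    have y: "y k = c k * y (Suc k) - y (Suc (Suc k))"
      and Y: "Y k = c k * Y (Suc k) - Y (Suc (Suc k))"
      using assms(1,2)[of k] step by (simp_all add: algebra_simps)
    show ?case unfolding y Y using step.IH by (simp add: algebra_simps)
  qed
  from this[of 0] show ?thesis by simp
qed

theorem theorem1p2:
  fixes w :: nat and q t lam lamb num den :: complex
  assumes "norm q < 1"
    and "t \<noteq> 0"
    and "(\<lambda>Nm. norm (G_term w t q Nm)) summable_on UNIV"
    and "lam\<^sup>2 - lam * (1 - q) / t + 1 = 0"
    and "lamb = 1 / lam"
    and "num = lam\<^sup>2 * (1 - q) *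
           (lamb ^ w * phi q lam (q ^ 3) * phi q lamb (q ^ (w + 3))
            - lam ^ w * phi q lamb (q ^ 3) * phi q lam (q ^ (w + 3)))"
    and "den = (1 + lam\<^sup>2) *
           (lamb ^ w * phi q lam (q ^ 2) * phi q lamb (q ^ (w + 3))
            - lam ^ (w + 2) * phi q lamb (q ^ 2) * phi q lam (q ^ (w + 3)))"
    and "\<And>k. qpoch (lam\<^sup>2 * q) q k * qpoch q q k \<noteq> 0"
    and "\<And>k. qpoch (lamb\<^sup>2 * q) q k * qpoch q q k \<noteq> 0"
    and "den \<noteq> 0"
    and "1 - num / den \<noteq> 0"
  shows "G w t q = 1 / (1 - num / den)"
proof -
  \<comment> \<open>By \<open>t_eq\<close>, \<open>c k\<close> is the reciprocal of
    \<open>t * qbracket q (Suc k)\<close>, the step weight at height \<open>k + 1\<close>.\<close>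
  define c where "c = (\<lambda>k. (lam + lamb) / (1 - q ^ (k + 2)))"
  define y where "y = path_gf w t q"
  define sol where "sol = (\<lambda>l k. l ^ k * phi q l (q ^ (k + 2)))"
  define Y where "Y = (\<lambda>k. sol lam k * sol lamb (Suc w) - sol lamb k * sol lam (Suc w))"
  have lam0: "lam \<noteq> 0" using assms(4) by auto
  have lamb0: "lamb \<noteq> 0" and inv: "lam = 1 / lamb" "lam * lamb = 1"
    using lam0 assms(5) by auto
  \<comment> \<open>This is the quadratic equation for \<open>lam\<close>, multiplied by
    \<open>t / lam\<close>.\<close>
  have t_eq: "t * (lam + lamb) = 1 - q"
  proof -
    have "lam * (t * (lam + lamb)) = t * (lam\<^sup>2 - lam * (1 - q) / t + 1) + lam * (1 - q)"
      using inv(2) assms(2) by (simp add: field_simps power2_eq_square)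
    then show ?thesis using assms(4) lam0 by simp
  qed
  have q_pow: "1 - q ^ Suc k \<noteq> 0" for k
    using assms(8)[of "Suc k"] by (auto simp: qpoch_def)
  have sums: "lam + 1 / lam = lam + lamb" "lamb + 1 / lamb = lam + lamb"
    by (simp only: assms(5), simp only: inv(1)[symmetric] add.commute)
  have sol_rec: "c k * sol l (Suc k) = sol l (k + 2) + sol l k"
    if "l \<noteq> 0" "l + 1 / l = lam + lamb"
      "\<And>k. qpoch (l\<^sup>2 * q) q k * qpoch q q k \<noteq> 0" for l k
    using phi_height_rec[OF assms(1) that(1,3), of k] q_pow[of "Suc k"] that(2)
    by (simp add: c_def sol_def field_simps eval_nat_numeral)
  have y_rec: "c k * y (Suc k) = y (k + 2) + y k" if "k < w" for k
  proof -
    have "y (Suc k) = t * qbracket q (Suc k) * (y (k + 2) + y k)"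
      using path_gf_rec[OF assms(3,2), of "Suc k"] that by (simp add: y_def)
    \<comment> \<open>The factor \<open>1 - q\<close> clears the q-bracket and is then traded for
      \<open>t * (lam + lamb)\<close>.\<close>
    then have "(1 - q) * y (Suc k) = t * ((1 - q) * qbracket q (Suc k)) * (y (k + 2) + y k)"
      by simp
    then have "(1 - q) * y (Suc k) = t * (1 - q ^ (k + 2)) * (y (k + 2) + y k)"
      unfolding qbracket_mult by simp
    then have "t * ((lam + lamb) * y (Suc k)) = t * ((1 - q ^ (k + 2)) * (y (k + 2) + y k))"
      by (simp only: t_eq[symmetric] mult.assoc)
    then have "(lam + lamb) * y (Suc k) = (1 - q ^ (k + 2)) * (y (k + 2) + y k)"
      using assms(2) by simp
    then show ?thesis using q_pow[of "Suc k"] by (simp add: c_def field_simps)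
  qed
  have Y_rec: "c k * Y (Suc k) = Y (k + 2) + Y k" for k
  proof -
    have "c k * Y (Suc k) = c k * sol lam (Suc k) * sol lamb (Suc w) -
        c k * sol lamb (Suc k) * sol lam (Suc w)"
      by (simp add: Y_def algebra_simps)
    also have "\<dots> = (sol lam (k + 2) + sol lam k) * sol lamb (Suc w) -
        (sol lamb (k + 2) + sol lamb k) * sol lam (Suc w)"
      by (simp only: sol_rec[OF lam0 sums(1) assms(8)] sol_rec[OF lamb0 sums(2) assms(9)])
    finally show ?thesis by (simp add: Y_def algebra_simps)
  qed
  have cross: "y 0 * Y 1 = y 1 * Y 0"
  proof (rule casoratian_zero[of w c])
    show "y (Suc w) = 0" by (simp add: y_def path_gf_def)
    show "Y (Suc w) = 0" by (simp add: Y_def)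
  qed (simp_all only: y_rec Y_rec)
  have y0: "y 0 - t * y 1 = 1"
    using path_gf_rec[OF assms(3,2), of 0] by (simp add: y_def qbracket_def)
  have "y 0 * (Y 0 - t * Y 1) = y 0 * Y 0 - t * (y 0 * Y 1)" by (simp add: algebra_simps)
  also have "\<dots> = (y 0 - t * y 1) * Y 0" unfolding cross by (simp add: algebra_simps)
  finally have main: "y 0 * (Y 0 - t * Y 1) = Y 0" unfolding y0 by simp
  have cancel: "lam * lamb ^ Suc w = lamb ^ w" "lamb * lam ^ Suc w = lam ^ w"
    using inv(2) by (simp_all add: mult.commute mult.left_commute)
  have Y1: "Y 1 = lamb ^ w * phi q lam (q ^ 3) * phi q lamb (q ^ (w + 3))
      - lam ^ w * phi q lamb (q ^ 3) * phi q lam (q ^ (w + 3))"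
    unfolding cancel[symmetric] by (simp add: Y_def sol_def eval_nat_numeral)
  \<comment> \<open>The extra \<open>lam\<close> turns \<open>lamb ^ Suc w\<close> into
    \<open>lamb ^ w\<close> and \<open>lam ^ Suc w\<close> into \<open>lam ^ (w + 2)\<close>, whence
    the uneven exponents. In \<open>Y 1\<close> it comes from the solutions themselves.\<close>
  have Y0: "lam * Y 0 = lamb ^ w * phi q lam (q ^ 2) * phi q lamb (q ^ (w + 3))
      - lam ^ (w + 2) * phi q lamb (q ^ 2) * phi q lam (q ^ (w + 3))"
    unfolding cancel(1)[symmetric] by (simp add: Y_def sol_def eval_nat_numeral algebra_simps)
  have lam_sq: "1 + lam\<^sup>2 = lam * (lam + lamb)"
    using inv(2) by (simp add: algebra_simps power2_eq_square)
  have num: "num = lam\<^sup>2 * (lam + lamb) * (t * Y 1)"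
    unfolding assms(6) Y1[symmetric] t_eq[symmetric] by simp
  have den: "den = lam\<^sup>2 * (lam + lamb) * Y 0"
    unfolding assms(7) Y0[symmetric] lam_sq by (simp add: power2_eq_square)
  have Y0_nz: "Y 0 \<noteq> 0" using assms(10) den by auto
  \<comment> \<open>The common factor \<open>lam\<^sup>2 * (lam + lamb)\<close> of
    \<open>num\<close> and \<open>den\<close> cancels; it is nonzero because \<open>den\<close>
    is.\<close>
  have frac: "1 - num / den = (Y 0 - t * Y 1) / Y 0"
    using assms(10) Y0_nz unfolding num den by (simp add: diff_divide_distrib)
  then have "Y 0 - t * Y 1 \<noteq> 0" using assms(11) by auto
  then show ?thesis
    using main Y0_nz G_eq_path_gf[OF assms(3)] unfolding frac y_def by (simp add: field_simps)
qed

end
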